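(* Consider the problem of minimizing over $\theta$ the cost $L(z(t_f))\in\mathbb{R}$ subject to $\dot z(t)=f(t,z(t),\theta(t))$ on $[t_0,t_f]$, where $z(t)\in\mathbb{R}^N$ and $\theta(t)\in\mathbb{R}^P$, and where: (1) the initial value $z(t_0)$ is a given constant, independent of $\theta$; (2) the initial time $t_0$ and the end time $t_f$ are fixed and the end point $z(t_f)$ is free; (3) $\theta(t)\equiv\theta$ does not change with time. Then the adjoint method gives the following. The adjoint variable $a(t)$ satisfies the backward ODE $$\dot a(t)=-a(t)\,\frac{\partial f}{\partial z}\Big|_*,\qquad a(t_f)=-\frac{\partial L}{\partial z(t_f)}\Big|_*,$$ and the gradient of the Lagrange cost $$J(\theta)=L(z(t_f))+\int_{t_0}^{t_f}a(t)\bigl(\dot z(t)-f(t,z(t),\theta(t))\bigr)\,dt$$ has the form $$\frac{dJ(\theta)}{d\theta}=-\int_{t_0}^{t_f}a(t)\,\frac{\partial f}{\partial\theta}\Big|_*\,dt .$$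
   Context: The adjoint variable $a(t)$ is the (row-vector valued, size $1\times N$) Lagrange multiplier appearing in $J$, chosen to be the solution of the stated terminal value problem. The symbol $|_*$ denotes evaluation at the original (unperturbed) parameter $\theta^*$ and the corresponding trajectory $z^*(t)$, that is, the solution of the constraint ODE with $\theta=\theta^*$; the gradient of $J$ is taken at $\theta^*$. Derivatives follow the convention $\bigl(\frac{\partial g}{\partial x}\bigr)_{ij}=\frac{\partial g_i}{\partial x_j}$, so $\frac{\partial f}{\partial z}$ is $N\times N$, $\frac{\partial f}{\partial\theta}$ is $N\times P$, and the derivative of a scalar function is a row vector. As in the source, the functions $f$ and $L$ are treated formally, with no explicit regularity assumptions.
   Formalization: Regularity is made explicit: f is continuous in (t,z,θ) with partial derivatives in z and θ that are jointly continuous, L is differentiable at z*(t_f), t_0 < t_f, and the trajectory z exists on [t_0,t_f] for every constant θ in an open set containing θ*. *)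

theory Defs
  imports "HOL-Analysis.Analysis"
begin

(* Row vectors are represented as elements of real ^ 'n and act on matrices by v* and on column
   vectors by the inner product. *)

definition row_derivative :: "(real ^ 'm \<Rightarrow> real) \<Rightarrow> real ^ 'm \<Rightarrow> real ^ 'm" where
  "row_derivative g x = (\<chi> j. frechet_derivative g (at x) (axis j 1))"

(* jacobian g (at x) $ i $ j is the partial derivative of g_i with respect to x_j. *)

definition state_jacobian ::
    "(real \<Rightarrow> real ^ 'n \<Rightarrow> real ^ 'p \<Rightarrow> real ^ 'n) \<Rightarrow> real \<Rightarrow> real ^ 'n \<Rightarrow> real ^ 'p \<Rightarrow> real ^ 'n ^ 'n" where
  "state_jacobian f t x \<theta> = jacobian (\<lambda>y. f t y \<theta>) (at x)"

definition param_jacobian ::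
    "(real \<Rightarrow> real ^ 'n \<Rightarrow> real ^ 'p \<Rightarrow> real ^ 'n) \<Rightarrow> real \<Rightarrow> real ^ 'n \<Rightarrow> real ^ 'p \<Rightarrow> real ^ 'p ^ 'n" where
  "param_jacobian f t x \<theta> = jacobian (\<lambda>\<eta>. f t x \<eta>) (at \<theta>)"

(* The regularity under which the formal computation is meaningful: continuity in all variables,
   and continuous differentiability in the state and the parameter (not in time). *)

definition C1_dynamics ::
    "(real \<Rightarrow> real ^ 'n \<Rightarrow> real ^ 'p \<Rightarrow> real ^ 'n) \<Rightarrow> real \<Rightarrow> real \<Rightarrow> (real ^ 'p) set \<Rightarrow> bool" where
  "C1_dynamics f t0 tf \<Theta> \<longleftrightarrow>
     continuous_on ({t0..tf} \<times> UNIV \<times> \<Theta>) (\<lambda>(t, x, \<theta>). f t x \<theta>) \<and>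
     (\<forall>t\<in>{t0..tf}. \<forall>x. \<forall>\<theta>\<in>\<Theta>.
        (\<lambda>y. f t y \<theta>) differentiable (at x) \<and> (\<lambda>\<eta>. f t x \<eta>) differentiable (at \<theta>)) \<and>
     continuous_on ({t0..tf} \<times> UNIV \<times> \<Theta>) (\<lambda>(t, x, \<theta>). state_jacobian f t x \<theta>) \<and>
     continuous_on ({t0..tf} \<times> UNIV \<times> \<Theta>) (\<lambda>(t, x, \<theta>). param_jacobian f t x \<theta>)"

definition trajectory ::
    "(real \<Rightarrow> real ^ 'n \<Rightarrow> real ^ 'p \<Rightarrow> real ^ 'n) \<Rightarrow> real \<Rightarrow> real \<Rightarrow> real ^ 'n \<Rightarrow>
     (real \<Rightarrow> real ^ 'p) \<Rightarrow> (real \<Rightarrow> real ^ 'n) \<Rightarrow> bool" where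
  "trajectory f t0 tf z0 \<theta> z \<longleftrightarrow>
     z t0 = z0 \<and>
     (\<forall>t\<in>{t0..tf}. (z has_vector_derivative f t (z t) (\<theta> t)) (at t within {t0..tf}))"

definition adjoint_variable ::
    "(real \<Rightarrow> real ^ 'n \<Rightarrow> real ^ 'p \<Rightarrow> real ^ 'n) \<Rightarrow> (real ^ 'n \<Rightarrow> real) \<Rightarrow> real \<Rightarrow> real \<Rightarrow>
     (real \<Rightarrow> real ^ 'p) \<Rightarrow> (real \<Rightarrow> real ^ 'n) \<Rightarrow> (real \<Rightarrow> real ^ 'n) \<Rightarrow> bool" where
  "adjoint_variable f L t0 tf \<theta> z a \<longleftrightarrow>
     (\<forall>t\<in>{t0..tf}.
        (a has_vector_derivative - (a t v* state_jacobian f t (z t) (\<theta> t))) (at t within {t0..tf})) \<and>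
     a tf = - row_derivative L (z tf)"

definition lagrange_cost ::
    "(real \<Rightarrow> real ^ 'n \<Rightarrow> real ^ 'p \<Rightarrow> real ^ 'n) \<Rightarrow> (real ^ 'n \<Rightarrow> real) \<Rightarrow> real \<Rightarrow> real \<Rightarrow>
     (real \<Rightarrow> real ^ 'n) \<Rightarrow> (real \<Rightarrow> real ^ 'p) \<Rightarrow> (real \<Rightarrow> real ^ 'n) \<Rightarrow> real" where
  "lagrange_cost f L t0 tf a \<theta> z =
     L (z tf) + integral {t0..tf}
       (\<lambda>t. a t \<bullet> (vector_derivative z (at t within {t0..tf}) - f t (z t) (\<theta> t)))"

end

theory Submission
  imports Defs
begin

text \<open>
  Along trajectories the constraint vanishes, so near \<open>\<theta>s\<close> the Lagrange cost equals the terminal cost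
  \<open>L (z \<theta> tf)\<close>. No linearized (sensitivity) equation is needed to differentiate it: put
  \<open>\<delta> t = z \<theta> t - z \<theta>s t\<close> and \<open>h = \<theta> - \<theta>s\<close>, and let \<open>A\<close>, \<open>B\<close> be the state and parameter Jacobians along
  \<open>z \<theta>s\<close>. The adjoint equation cancels the \<open>A\<close>-terms in the derivative of \<open>a t \<bullet> \<delta> t\<close>, which is therefore
  \<open>(a t v* B t) \<bullet> h\<close> up to \<open>a t\<close> paired with the first-order Taylor remainder of \<open>f\<close>. By uniform continuity
  of the Jacobians on a compact tube this remainder is \<open>o(norm (\<delta> t) + norm h)\<close> uniformly in \<open>t\<close>, and a
  Gronwall estimate gives \<open>\<delta> = O(norm h)\<close>. Integrating and inserting \<open>a tf = - row_derivative L (z \<theta>s tf)\<close>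
  gives the gradient. The adjoint variable exists by a contraction argument in an exponentially
  weighted norm, and is unique by the same Gronwall estimate in reversed time.
\<close>

section \<open>Bilinearity of the matrix actions and backward differential equations\<close>

lemma bounded_bilinear_matrix_vector_mult:
  "bounded_bilinear (\<lambda>(A::real^'m^'n) x. A *v x)"
  by (auto simp: bilinear_conv_bounded_bilinear[symmetric] bilinear_def linear_iff algebra_simps
      scaleR_matrix_vector_assoc)

lemma bounded_bilinear_vector_matrix_mult:
  "bounded_bilinear (\<lambda>x (A::real^'m^'n). x v* A)"
  by (auto simp: bilinear_conv_bounded_bilinear[symmetric] bilinear_def linear_iff algebra_simps
      scaleR_vector_matrix_assoc vector_scaleR_matrix_ac)

text \<open>Picard iteration for the backward integral equation. The unknown is rescaled as
  \<open>u = w * p\<close>, so that the sup norm of \<open>p\<close> is a weighted norm of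
  \<open>u\<close>; a global Lipschitz constant then gives a contraction on all of
  \<open>{a..b}\<close>, however long the interval.\<close>

lemma terminal_value_problem_solution:
  fixes g :: "real \<Rightarrow> 'a::banach \<Rightarrow> 'a"
  assumes "a \<le> b" "0 \<le> M"
    and cont: "continuous_on ({a..b} \<times> UNIV) (\<lambda>(t, x). g t x)"
    and lip: "\<And>t x y. t \<in> {a..b} \<Longrightarrow> norm (g t x - g t y) \<le> M * norm (x - y)"
  obtains u where "u b = c"
    and "\<And>t. t \<in> {a..b} \<Longrightarrow> (u has_vector_derivative g t (u t)) (at t within {a..b})"
proof -
  \<comment> \<open>The factor \<open>2\<close> yields the contraction constant
    \<open>1 / 2\<close>; the summand \<open>1\<close> keeps \<open>K\<close> positive when
    \<open>M = 0\<close>.\<close>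
  define K where "K = 2 * M + 1"
  have K: "K > 0" "M / K \<le> 1 / 2"
    using \<open>0 \<le> M\<close> by (auto simp: K_def field_simps)
  \<comment> \<open>The weight \<open>w\<close> makes the integral operator a contraction on the whole interval.\<close>
  define w where "w t = exp (K * (b - t))" for t
  have w_pos: "w t > 0" for t
    by (simp add: w_def)
  have w_cont: "continuous_on S w" for S
    unfolding w_def by (intro continuous_intros)
  have cont_rhs: "continuous_on S (\<lambda>s. g s (v s))" if "continuous_on S v" "S \<subseteq> {a..b}" for v S
    using continuous_on_compose2[OF cont, of S "\<lambda>s. (s, v s)"] that
    by (force intro!: continuous_intros)
  \<comment> \<open>The integral operator conjugated by multiplication with \<open>w\<close>: a
    fixed point \<open>p\<close> of \<open>P\<close> corresponds to the solution
    \<open>w * p\<close>.\<close>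
  define P where "P v t = (1 / w t) *\<^sub>R (c - integral {t..b} (\<lambda>s. g s (w s *\<^sub>R v s)))" for v t
  have P_cont: "continuous_on (cbox a b) (P v)" if "continuous_on {a..b} v" for v
  proof -
    have "continuous_on {a..b} (\<lambda>t. integral {t..b} (\<lambda>s. g s (w s *\<^sub>R v s)))"
      by (rule continuous_on_vector_derivative[OF integral_has_vector_derivative'])
        (auto intro!: cont_rhs continuous_intros w_cont that)
    then show ?thesis
      unfolding P_def using w_pos
      by (auto intro!: continuous_intros w_cont simp: less_imp_neq[symmetric])
  qed
  \<comment> \<open>Clamping the argument extends \<open>P p\<close> by its endpoint values to the
    whole line, which places it in the complete space of bounded continuous functions.\<close>
  have "\<exists>q::real \<Rightarrow>\<^sub>C 'a. \<forall>t. q t = P p (clamp a b t)" for p :: "real \<Rightarrow>\<^sub>C 'a"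
    by (rule continuous_on_cbox_bcontfunE[OF P_cont[of p]]) auto
  then obtain T :: "(real \<Rightarrow>\<^sub>C 'a) \<Rightarrow> real \<Rightarrow>\<^sub>C 'a" where T: "T p t = P p (clamp a b t)" for p t
    by metis
  have P_contr: "norm (P p t - P q t) \<le> 1 / 2 * dist p q"
    if t: "t \<in> {a..b}" for t and p q :: "real \<Rightarrow>\<^sub>C 'a"
  proof -
    let ?D = "dist p q"
    have int: "(\<lambda>s. g s (w s *\<^sub>R r s)) integrable_on {t..b}" for r :: "real \<Rightarrow>\<^sub>C 'a"
      using t by (auto intro!: integrable_continuous_real cont_rhs continuous_intros w_cont)
    have bound: "norm (g s (w s *\<^sub>R q s) - g s (w s *\<^sub>R p s)) \<le> M * ?D * w s"
      if "s \<in> {t..b}" for s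
    proof -
      have "norm (g s (w s *\<^sub>R q s) - g s (w s *\<^sub>R p s)) \<le> M * norm (w s *\<^sub>R q s - w s *\<^sub>R p s)"
        using lip t that by auto
      also have "norm (w s *\<^sub>R q s - w s *\<^sub>R p s) = w s * dist (p s) (q s)"
        using w_pos[of s] by (simp add: scaleR_diff_right[symmetric] dist_norm norm_minus_commute)
      also have "M * (w s * dist (p s) (q s)) \<le> M * (w s * ?D)"
        using w_pos[of s] \<open>0 \<le> M\<close> by (intro mult_left_mono dist_bounded) auto
      finally show ?thesis by (simp add: mult_ac)
    qed
    \<comment> \<open>The antiderivative of \<open>w\<close> is \<open>- w / K\<close>, and
      \<open>w b = 1\<close>. The integral of \<open>w\<close> over \<open>{t..b}\<close> is thus at
      most \<open>w t / K\<close>, and the prefactor \<open>1 / w t\<close> leaves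
      \<open>1 / K\<close>.\<close>
    have "((\<lambda>s. M * ?D * w s) has_integral (- M * ?D / K * w b) - (- M * ?D / K * w t)) {t..b}"
      using t K by (intro fundamental_theorem_of_calculus)
        (auto intro!: derivative_eq_intros simp: w_def has_real_derivative_iff_has_vector_derivative[symmetric])
    then have exp_int: "((\<lambda>s. M * ?D * w s) has_integral M * ?D / K * (w t - 1)) {t..b}"
      by (simp add: w_def algebra_simps)
    have "norm (P p t - P q t)
        = (1 / w t) * norm (integral {t..b} (\<lambda>s. g s (w s *\<^sub>R q s) - g s (w s *\<^sub>R p s)))"
      using w_pos[of t]
      by (simp add: P_def scaleR_diff_right[symmetric] integral_diff[OF int int])
    also have "\<dots> \<le> (1 / w t) * (M * ?D / K * (w t - 1))"
    proof (rule mult_left_mono)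
      show "norm (integral {t..b} (\<lambda>s. g s (w s *\<^sub>R q s) - g s (w s *\<^sub>R p s)))
          \<le> M * ?D / K * (w t - 1)"
        using integral_norm_bound_integral[OF integrable_diff[OF int int] has_integral_integrable[OF exp_int] bound]
        by (simp only: integral_unique[OF exp_int])
    qed (use w_pos[of t] in auto)
    also have "\<dots> \<le> (1 / w t) * (M * ?D / K * w t)"
      using w_pos[of t] K \<open>0 \<le> M\<close> by (intro mult_left_mono) auto
    also have "\<dots> = (M / K) * ?D"
      using w_pos[of t] by simp
    also have "\<dots> \<le> 1 / 2 * ?D"
      using K by (intro mult_right_mono) auto
    finally show ?thesis .
  qed
  have "\<exists>!p. T p = p"
  proof (rule banach_fix_type)
    show "\<forall>p q. dist (T p) (T q) \<le> 1 / 2 * dist p q"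
    proof (intro allI dist_bound)
      fix p q t
      have "clamp a b t \<in> {a..b}"
        using clamp_in_interval[of a b t] \<open>a \<le> b\<close> by simp
      then show "dist (T p t) (T q t) \<le> 1 / 2 * dist p q"
        using P_contr unfolding T dist_norm[of "P _ _"] by blast
    qed
  qed auto
  then obtain p where p: "T p = p"
    by auto
  have fixed: "p t = P p t" if "t \<in> {a..b}" for t
    using T[of p t] that by (simp add: p)
  define u where "u t = c - integral {t..b} (\<lambda>s. g s (w s *\<^sub>R p s))" for t
  have u: "u t = w t *\<^sub>R p t" if "t \<in> {a..b}" for t
    using fixed[OF that] w_pos[of t] by (simp add: P_def u_def)
  show ?thesis
  proof
    show "u b = c" by (simp add: u_def)
    show "(u has_vector_derivative g t (u t)) (at t within {a..b})" if t: "t \<in> {a..b}" for t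
      \<comment> \<open>The value \<open>u t\<close> inside \<open>g\<close> becomes
        \<open>w t *\<^sub>R p t\<close>, while the function being differentiated becomes its
        integral form.\<close>
      unfolding u[OF t] unfolding u_def
      using t by (auto intro!: derivative_eq_intros integral_has_vector_derivative' cont_rhs
          continuous_intros w_cont)
  qed
qed

section \<open>Gronwall estimates\<close>

text \<open>The growth bound makes the derivative of \<open>norm (d s)\<close> squared at most
  \<open>M\<close> times \<open>2 * (norm (d s))\<^sup>2 + 2 * norm (d s) * \<eta>\<close>. Since
  \<open>2 * x * y\<close> is at most the sum of the squares, this is at most \<open>3 * M\<close>
  times \<open>(norm (d s))\<^sup>2 + \<eta>\<^sup>2\<close>, whence the rate
  \<open>3 * M\<close>.\<close>

lemma gronwall_zero_initial:
  fixes d :: "real \<Rightarrow> 'a::real_inner"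
  assumes "d a = 0" "0 \<le> M" "0 \<le> \<eta>" "t \<in> {a..b}"
    and deriv: "\<And>s. s \<in> {a..b} \<Longrightarrow> (d has_vector_derivative d' s) (at s within {a..b})"
    and growth: "\<And>s. s \<in> {a..b} \<Longrightarrow> norm (d' s) \<le> M * (norm (d s) + \<eta>)"
  shows "norm (d t) \<le> exp (3 * M * (t - a)) * \<eta>"
\<comment> \<open>The mean value theorem applied below requires \<open>a < t\<close>.\<close>
proof (cases "t = a")
  case True
  then show ?thesis using assms by simp
next
  case False
  then have "a < t" using assms by auto
  \<comment> \<open>\<open>\<phi>\<close> is nonincreasing; squaring the norm avoids its nondifferentiability at \<open>0\<close>.\<close>
  define \<phi> where "\<phi> s = exp (- 3 * M * s) * (d s \<bullet> d s + \<eta>\<^sup>2)" for s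
  define \<phi>' where "\<phi>' s = exp (- 3 * M * s) * (2 * (d s \<bullet> d' s) - 3 * M * (d s \<bullet> d s + \<eta>\<^sup>2))" for s
  have "(\<phi> has_derivative (\<lambda>h. h * \<phi>' s)) (at s within {a..t})" if "a \<le> s" "s \<le> t" for s
  proof -
    have *: "(d has_derivative (\<lambda>h. h *\<^sub>R d' s)) (at s within {a..t})"
      using has_vector_derivative_within_subset[OF deriv, of s "{a..t}"] that assms
      by (auto simp: has_vector_derivative_def)
    show ?thesis
      unfolding \<phi>_def \<phi>'_def
      by (rule derivative_eq_intros * refl)+ (auto simp: algebra_simps inner_commute fun_eq_iff)
  qed
  from mvt_simple[OF \<open>a < t\<close> this] obtain s
    where s: "s \<in> {a<..<t}" "\<phi> t - \<phi> a = (t - a) * \<phi>' s" by auto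
  have "2 * (d s \<bullet> d' s) \<le> 2 * (norm (d s) * norm (d' s))"
    using norm_cauchy_schwarz by auto
  also have "\<dots> \<le> 2 * (norm (d s) * (M * (norm (d s) + \<eta>)))"
    using growth[of s] s assms by (intro mult_left_mono) auto
  also have "\<dots> = M * (2 * (norm (d s))\<^sup>2 + 2 * norm (d s) * \<eta>)"
    by (simp add: power2_eq_square algebra_simps)
  also have "\<dots> \<le> M * (3 * ((norm (d s))\<^sup>2 + \<eta>\<^sup>2))"
  proof (rule mult_left_mono)
    show "2 * (norm (d s))\<^sup>2 + 2 * norm (d s) * \<eta> \<le> 3 * ((norm (d s))\<^sup>2 + \<eta>\<^sup>2)"
      using sum_squares_bound[of "norm (d s)" \<eta>] by (smt (verit) zero_le_power2)
  qed fact
  also have "\<dots> = 3 * M * ((norm (d s))\<^sup>2 + \<eta>\<^sup>2)"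
    by simp
  finally have "\<phi>' s \<le> 0"
    by (simp add: \<phi>'_def mult_le_0_iff power2_norm_eq_inner)
  then have "\<phi> t \<le> \<phi> a"
    using s \<open>a < t\<close> by (smt (verit) mult_nonneg_nonpos)
  then have "exp (3 * M * t) * \<phi> t \<le> exp (3 * M * t) * \<phi> a"
    by simp
  then have "d t \<bullet> d t + \<eta>\<^sup>2 \<le> exp (3 * M * (t - a)) * \<eta>\<^sup>2"
    using \<open>d a = 0\<close> by (simp add: \<phi>_def mult.assoc[symmetric] exp_add[symmetric] right_diff_distrib)
  then have "(norm (d t))\<^sup>2 \<le> exp (3 * M * (t - a)) * \<eta>\<^sup>2"
    by (simp add: power2_norm_eq_inner) (smt (verit) zero_le_power2)
  \<comment> \<open>The exponent is nonnegative, so squaring the exponential only enlarges it; both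
    sides are then squares and the root can be taken.\<close>
  also have "\<dots> \<le> (exp (3 * M * (t - a)))\<^sup>2 * \<eta>\<^sup>2"
    using \<open>a < t\<close> \<open>0 \<le> M\<close> by (intro mult_right_mono) (auto simp: power2_eq_square)
  finally have "(norm (d t))\<^sup>2 \<le> (exp (3 * M * (t - a)) * \<eta>)\<^sup>2"
    by (simp add: power_mult_distrib)
  then show ?thesis
    by (rule power2_le_imp_le) (simp add: \<open>0 \<le> \<eta>\<close>)
qed

text \<open>A continuity argument: up to the first time at which \<open>norm (d s)\<close> reaches
  \<open>r\<close> the growth bound is available, yet the resulting estimate stays strictly below
  \<open>r\<close>, so that time never comes. This form suits dynamics controlled only in a tube
  around a reference trajectory.\<close>

lemma gronwall_zero_initial_local:
  fixes d :: "real \<Rightarrow> 'a::real_inner"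
  assumes "d a = 0" "0 \<le> M" "0 \<le> \<eta>" "t \<in> {a..b}"
    and deriv: "\<And>s. s \<in> {a..b} \<Longrightarrow> (d has_vector_derivative d' s) (at s within {a..b})"
    and growth: "\<And>s. s \<in> {a..b} \<Longrightarrow> norm (d s) \<le> r \<Longrightarrow> norm (d' s) \<le> M * (norm (d s) + \<eta>)"
    and small: "exp (3 * M * (b - a)) * \<eta> < r"
  shows "norm (d t) \<le> exp (3 * M * (b - a)) * \<eta>"
proof -
  have bound: "norm (d T) \<le> exp (3 * M * (b - a)) * \<eta>"
    if T: "T \<in> {a..b}" and "\<And>s. s \<in> {a..T} \<Longrightarrow> norm (d s) \<le> r" for T
  proof -
    have "norm (d T) \<le> exp (3 * M * (T - a)) * \<eta>"
    proof (rule gronwall_zero_initial[where b = T and d' = d'])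
      show "(d has_vector_derivative d' s) (at s within {a..T})" if "s \<in> {a..T}" for s
        using has_vector_derivative_within_subset[OF deriv, of s "{a..T}"] T that by auto
    qed (use assms that in auto)
    also have "\<dots> \<le> exp (3 * M * (b - a)) * \<eta>"
      using T assms by (intro mult_right_mono) (auto intro!: mult_left_mono)
    finally show ?thesis .
  qed
  have cont: "continuous_on {a..b} d"
    by (rule continuous_on_vector_derivative[OF deriv])
  have "norm (d s) < r" if "s \<in> {a..b}" for s
  proof (rule ccontr)
    assume "\<not> norm (d s) < r"
    \<comment> \<open>\<open>E\<close> collects the times at which \<open>d\<close> has left the
      open ball of radius \<open>r\<close>; compactness provides a first one,
      \<open>T\<close>.\<close>
    define E where "E = {s \<in> {a..b}. r \<le> norm (d s)}"
    have "compact E"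
    proof -
      have "closed E"
        unfolding E_def by (intro continuous_on_closed_Collect_le continuous_intros cont)
      moreover have "bounded E"
        by (rule bounded_subset[OF bounded_closed_interval[of a b]]) (auto simp: E_def)
      ultimately show ?thesis
        by (simp add: compact_eq_bounded_closed)
    qed
    moreover have "E \<noteq> {}"
      using that \<open>\<not> norm (d s) < r\<close> by (auto simp: E_def)
    ultimately obtain T where T: "T \<in> E" "\<And>s. s \<in> E \<Longrightarrow> T \<le> s"
      using compact_attains_inf by metis
    have below: "norm (d s) < r" if "s \<in> {a..<T}" for s
      using T that by (force simp: E_def)
    \<comment> \<open>Only times before \<open>T\<close> are known to lie in the ball, so the bound
      is carried to \<open>T\<close> by continuity. For \<open>T = a\<close> there are no earlier
      times and \<open>d a = 0\<close> is used instead.\<close>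
    have "norm (d T) \<le> r"
    proof (cases "T = a")
      case True
      then show ?thesis
        using \<open>d a = 0\<close> small \<open>0 \<le> \<eta>\<close> by (simp add: order_trans[OF _ less_imp_le[OF small]])
    next
      case False
      then have "a < T" using T by (auto simp: E_def)
      have "continuous_on (closure {a..<T}) d"
        by (rule continuous_on_subset[OF cont]) (use T \<open>a < T\<close> in \<open>auto simp: E_def\<close>)
      then show ?thesis
        by (rule continuous_on_closure_norm_le) (use below \<open>a < T\<close> in \<open>auto intro: less_imp_le\<close>)
    qed
    then have "norm (d T) \<le> exp (3 * M * (b - a)) * \<eta>"
      using T below by (intro bound) (auto simp: E_def less_imp_le le_less)
    then show False
      using T small by (auto simp: E_def)
  qed
  then show ?thesis
    using \<open>t \<in> {a..b}\<close> by (intro bound) (auto intro: less_imp_le)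
qed

section \<open>Uniform linearization of the dynamics\<close>

text \<open>The mean value inequality applied to \<open>\<phi> u - A *v u\<close>, whose derivative
  \<open>D u - A\<close> is small on \<open>S\<close>. The constant \<open>C\<close> converts the
  norm of a matrix, taken as a vector of rows, into an operator bound.\<close>

lemma matrix_derivative_linearization:
  fixes \<phi> :: "real^'m \<Rightarrow> real^'n"
  assumes "convex S" "x \<in> S" "y \<in> S" "0 \<le> C"
    and C: "\<And>(A::real^'m^'n) h. norm (A *v h) \<le> norm A * norm h * C"
    and deriv: "\<And>u. u \<in> S \<Longrightarrow> (\<phi> has_derivative (\<lambda>h. D u *v h)) (at u)"
    and close: "\<And>u. u \<in> S \<Longrightarrow> norm (D u - A) \<le> e"
  shows "norm (\<phi> y - \<phi> x - A *v (y - x)) \<le> C * e * norm (y - x)"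
proof -
  have "norm ((\<phi> y - A *v y) - (\<phi> x - A *v x)) \<le> C * e * norm (y - x)"
  proof (rule differentiable_bound[OF \<open>convex S\<close> _ _ \<open>y \<in> S\<close> \<open>x \<in> S\<close>])
    fix u assume u: "u \<in> S"
    show "((\<lambda>u. \<phi> u - A *v u) has_derivative (\<lambda>h. (D u - A) *v h)) (at u within S)"
      unfolding matrix_vector_mult_diff_rdistrib
      by (intro has_derivative_diff has_derivative_at_withinI[OF deriv] u
          bounded_linear_imp_has_derivative matrix_vector_mul_bounded_linear)
    show "onorm (\<lambda>h. (D u - A) *v h) \<le> C * e"
    proof (rule onorm_le)
      fix h
      have "norm ((D u - A) *v h) \<le> norm (D u - A) * norm h * C"
        by (rule C)
      also have "\<dots> \<le> e * norm h * C"
        using close[OF u] \<open>0 \<le> C\<close> by (intro mult_right_mono) auto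
      finally show "norm ((D u - A) *v h) \<le> C * e * norm h"
        by (simp add: mult_ac)
    qed
  qed
  then show ?thesis
    by (simp add: matrix_vector_mult_diff_distrib algebra_simps)
qed

lemma C1_dynamics_state_derivative:
  assumes "C1_dynamics f t0 tf \<Theta>" "t \<in> {t0..tf}" "\<theta> \<in> \<Theta>"
  shows "((\<lambda>y. f t y \<theta>) has_derivative (\<lambda>h. state_jacobian f t x \<theta> *v h)) (at x)"
  using assms unfolding C1_dynamics_def state_jacobian_def jacobian_works[symmetric] by auto

lemma C1_dynamics_param_derivative:
  assumes "C1_dynamics f t0 tf \<Theta>" "t \<in> {t0..tf}" "\<theta> \<in> \<Theta>"
  shows "((\<lambda>\<eta>. f t x \<eta>) has_derivative (\<lambda>h. param_jacobian f t x \<theta> *v h)) (at \<theta>)"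
  using assms unfolding C1_dynamics_def param_jacobian_def jacobian_works[symmetric] by auto

lemma C1_dynamics_continuous_along:
  assumes "C1_dynamics f t0 tf \<Theta>" "\<theta> \<in> \<Theta>" "continuous_on {t0..tf} x"
  shows "continuous_on {t0..tf} (\<lambda>t. state_jacobian f t (x t) \<theta>)"
    and "continuous_on {t0..tf} (\<lambda>t. param_jacobian f t (x t) \<theta>)"
proof -
  have pair: "continuous_on {t0..tf} (\<lambda>t. (t, x t, \<theta>))"
    "(\<lambda>t. (t, x t, \<theta>)) ` {t0..tf} \<subseteq> {t0..tf} \<times> UNIV \<times> \<Theta>"
    using assms by (auto intro!: continuous_intros)
  show "continuous_on {t0..tf} (\<lambda>t. state_jacobian f t (x t) \<theta>)"
    "continuous_on {t0..tf} (\<lambda>t. param_jacobian f t (x t) \<theta>)"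
    using assms(1) continuous_on_compose2[OF _ pair] unfolding C1_dynamics_def by fastforce+
qed

text \<open>The point is that \<open>r\<close> does not depend on \<open>t\<close>. The trajectory
  is bounded and \<open>\<Theta>\<close> is open, so a tube around the trajectory fits into a
  compact box, where continuity is uniform.\<close>

lemma continuous_on_tube_uniform:
  fixes G :: "real \<Rightarrow> 'a::euclidean_space \<Rightarrow> 'b::euclidean_space \<Rightarrow> 'c::metric_space"
  assumes G: "continuous_on ({a..b} \<times> UNIV \<times> \<Theta>) (\<lambda>(t, y, \<theta>). G t y \<theta>)"
    and x: "continuous_on {a..b} x" and "open \<Theta>" "\<theta>s \<in> \<Theta>" "0 < e"
  obtains r where "0 < r" and "cball \<theta>s r \<subseteq> \<Theta>"
    and "\<And>t y \<theta>. t \<in> {a..b} \<Longrightarrow> dist y (x t) \<le> r \<Longrightarrow> dist \<theta> \<theta>s \<le> r \<Longrightarrow> dist (G t y \<theta>) (G t (x t) \<theta>s) < e"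
proof -
  obtain \<rho> where \<rho>: "0 < \<rho>" "cball \<theta>s \<rho> \<subseteq> \<Theta>"
    using \<open>open \<Theta>\<close> \<open>\<theta>s \<in> \<Theta>\<close> open_contains_cball by metis
  obtain R where R: "\<And>t. t \<in> {a..b} \<Longrightarrow> norm (x t) \<le> R"
    using compact_imp_bounded[OF compact_continuous_image[OF x compact_Icc]]
    unfolding bounded_iff by blast
  let ?K = "{a..b} \<times> cball 0 (R + 1) \<times> cball \<theta>s \<rho>"
  have "uniformly_continuous_on ?K (\<lambda>(t, y, \<theta>). G t y \<theta>)"
    using \<rho> by (intro compact_uniformly_continuous continuous_on_subset[OF G] compact_Times
        compact_cball compact_Icc) auto
  then obtain d where d: "0 < d"
    "\<And>p q. p \<in> ?K \<Longrightarrow> q \<in> ?K \<Longrightarrow> dist q p < d \<Longrightarrow>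
      dist ((\<lambda>(t, y, \<theta>). G t y \<theta>) q) ((\<lambda>(t, y, \<theta>). G t y \<theta>) p) < e"
    using \<open>0 < e\<close> unfolding uniformly_continuous_on_def by metis
  \<comment> \<open>The bound \<open>1\<close> keeps \<open>y\<close> in the ball of radius
    \<open>R + 1\<close>, \<open>\<rho>\<close> keeps the parameter in its ball, and two distances
    of at most \<open>d / 3\<close> add up to less than \<open>d\<close>.\<close>
  define r where "r = min (min 1 \<rho>) (d / 3)"
  show ?thesis
  proof
    show "0 < r" "cball \<theta>s r \<subseteq> \<Theta>"
      using \<rho> d(1) by (auto simp: r_def)
    fix t y \<theta> assume t: "t \<in> {a..b}" and y: "dist y (x t) \<le> r" and \<theta>: "dist \<theta> \<theta>s \<le> r"
    have "dist (t, y, \<theta>) (t, x t, \<theta>s) \<le> dist y (x t) + dist \<theta> \<theta>s"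
      by (simp add: dist_Pair_Pair sqrt_sum_squares_le_sum)
    also have "\<dots> < d"
      using y \<theta> d(1) by (auto simp: r_def)
    finally have "dist (t, y, \<theta>) (t, x t, \<theta>s) < d" .
    moreover have "norm y \<le> R + 1"
      using y R[OF t] norm_triangle_ineq[of "x t" "y - x t"] by (auto simp: r_def dist_norm)
    ultimately show "dist (G t y \<theta>) (G t (x t) \<theta>s) < e"
      using d(2)[of "(t, x t, \<theta>s)" "(t, y, \<theta>)"] t \<theta> R[OF t] \<rho>(1)
      by (auto simp: r_def dist_commute)
  qed
qed

text \<open>The increment is split at \<open>f t (x t) \<theta>\<close>: first the state moves at
  the perturbed parameter, then the parameter moves at the reference state. Each piece needs only a
  partial Jacobian close to its value on the reference trajectory.\<close>

lemma C1_dynamics_uniform_remainder: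
  fixes f :: "real \<Rightarrow> real^'n \<Rightarrow> real^'p \<Rightarrow> real^'n"
  assumes dyn: "C1_dynamics f t0 tf \<Theta>" and "open \<Theta>" "\<theta>s \<in> \<Theta>"
    and x: "continuous_on {t0..tf} x" and "0 < e"
  obtains r where "0 < r" and "cball \<theta>s r \<subseteq> \<Theta>"
    and "\<And>t y \<theta>. t \<in> {t0..tf} \<Longrightarrow> norm (y - x t) \<le> r \<Longrightarrow> norm (\<theta> - \<theta>s) \<le> r \<Longrightarrow>
      norm (f t y \<theta> - f t (x t) \<theta>s
        - (state_jacobian f t (x t) \<theta>s *v (y - x t) + param_jacobian f t (x t) \<theta>s *v (\<theta> - \<theta>s)))
      \<le> e * (norm (y - x t) + norm (\<theta> - \<theta>s))"
proof -
  obtain C1 where C1: "0 < C1" "\<And>(A::real^'n^'n) h. norm (A *v h) \<le> norm A * norm h * C1"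
    using bounded_bilinear.pos_bounded[OF bounded_bilinear_matrix_vector_mult] by blast
  obtain C2 where C2: "0 < C2" "\<And>(A::real^'p^'n) h. norm (A *v h) \<le> norm A * norm h * C2"
    using bounded_bilinear.pos_bounded[OF bounded_bilinear_matrix_vector_mult] by blast
  have cont: "continuous_on ({t0..tf} \<times> UNIV \<times> \<Theta>) (\<lambda>(t, x, \<theta>). state_jacobian f t x \<theta>)"
    "continuous_on ({t0..tf} \<times> UNIV \<times> \<Theta>) (\<lambda>(t, x, \<theta>). param_jacobian f t x \<theta>)"
    using dyn by (auto simp: C1_dynamics_def)
  \<comment> \<open>The tolerances \<open>e / C1\<close> and \<open>e / C2\<close> cancel the
    constants that the linearization estimate brings in.\<close>
  obtain r1 where r1: "0 < r1" "cball \<theta>s r1 \<subseteq> \<Theta>"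
    "\<And>t y \<theta>. t \<in> {t0..tf} \<Longrightarrow> dist y (x t) \<le> r1 \<Longrightarrow> dist \<theta> \<theta>s \<le> r1 \<Longrightarrow>
      dist (state_jacobian f t y \<theta>) (state_jacobian f t (x t) \<theta>s) < e / C1"
    using continuous_on_tube_uniform[OF cont(1) x \<open>open \<Theta>\<close> \<open>\<theta>s \<in> \<Theta>\<close>, of "e / C1"] \<open>0 < e\<close> C1(1)
    by auto
  obtain r2 where r2: "0 < r2" "cball \<theta>s r2 \<subseteq> \<Theta>"
    "\<And>t y \<theta>. t \<in> {t0..tf} \<Longrightarrow> dist y (x t) \<le> r2 \<Longrightarrow> dist \<theta> \<theta>s \<le> r2 \<Longrightarrow>
      dist (param_jacobian f t y \<theta>) (param_jacobian f t (x t) \<theta>s) < e / C2"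
    using continuous_on_tube_uniform[OF cont(2) x \<open>open \<Theta>\<close> \<open>\<theta>s \<in> \<Theta>\<close>, of "e / C2"] \<open>0 < e\<close> C2(1)
    by auto
  show ?thesis
  proof
    let ?r = "min r1 r2"
    show "0 < ?r" "cball \<theta>s ?r \<subseteq> \<Theta>"
      using r1 r2 by auto
    fix t y \<theta> assume t: "t \<in> {t0..tf}" and y: "norm (y - x t) \<le> ?r" and \<theta>: "norm (\<theta> - \<theta>s) \<le> ?r"
    let ?A = "state_jacobian f t (x t) \<theta>s" and ?B = "param_jacobian f t (x t) \<theta>s"
    have "\<theta> \<in> \<Theta>"
      using \<theta> r1(2) by (auto simp: dist_norm norm_minus_commute)
    have "norm (f t y \<theta> - f t (x t) \<theta> - ?A *v (y - x t)) \<le> C1 * (e / C1) * norm (y - x t)"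
    proof (rule matrix_derivative_linearization[OF convex_cball _ _ less_imp_le[OF C1(1)] C1(2)])
      show "((\<lambda>y. f t y \<theta>) has_derivative (\<lambda>h. state_jacobian f t u \<theta> *v h)) (at u)" for u
        by (rule C1_dynamics_state_derivative[OF dyn t \<open>\<theta> \<in> \<Theta>\<close>])
      show "norm (state_jacobian f t u \<theta> - ?A) \<le> e / C1" if "u \<in> cball (x t) r1" for u
        using r1(3)[OF t, of u \<theta>] that \<theta> by (auto simp: dist_norm norm_minus_commute)
    qed (use y r1 in \<open>auto simp: dist_norm norm_minus_commute\<close>)
    moreover have "norm (f t (x t) \<theta> - f t (x t) \<theta>s - ?B *v (\<theta> - \<theta>s)) \<le> C2 * (e / C2) * norm (\<theta> - \<theta>s)"
    proof (rule matrix_derivative_linearization[OF convex_cball _ _ less_imp_le[OF C2(1)] C2(2)])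
      show "(f t (x t) has_derivative (\<lambda>h. param_jacobian f t (x t) u *v h)) (at u)"
        if "u \<in> cball \<theta>s r2" for u
        using C1_dynamics_param_derivative[OF dyn t, of u "x t"] that r2(2) by auto
      show "norm (param_jacobian f t (x t) u - ?B) \<le> e / C2" if "u \<in> cball \<theta>s r2" for u
        using r2(3)[OF t, of "x t" u] that r2(1) by (auto simp: dist_norm norm_minus_commute)
    qed (use \<theta> r2 in \<open>auto simp: dist_norm norm_minus_commute\<close>)
    moreover have "f t y \<theta> - f t (x t) \<theta>s - (?A *v (y - x t) + ?B *v (\<theta> - \<theta>s))
      = (f t y \<theta> - f t (x t) \<theta> - ?A *v (y - x t)) + (f t (x t) \<theta> - f t (x t) \<theta>s - ?B *v (\<theta> - \<theta>s))"
      by simp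
    ultimately show "norm (f t y \<theta> - f t (x t) \<theta>s - (?A *v (y - x t) + ?B *v (\<theta> - \<theta>s)))
      \<le> e * (norm (y - x t) + norm (\<theta> - \<theta>s))"
      using C1(1) C2(1) by (simp only:) (rule norm_triangle_le, simp add: algebra_simps)
  qed
qed

lemma matrix_vector_mult_uniform_bound:
  fixes A :: "'a::topological_space \<Rightarrow> real^'m^'n"
  assumes "continuous_on S A" "compact S"
  obtains M where "0 \<le> M" "\<And>t h. t \<in> S \<Longrightarrow> norm (A t *v h) \<le> M * norm h"
proof -
  obtain C where C: "0 < C" "\<And>(A::real^'m^'n) h. norm (A *v h) \<le> norm A * norm h * C"
    using bounded_bilinear.pos_bounded[OF bounded_bilinear_matrix_vector_mult] by blast
  obtain R where R: "0 < R" "\<And>t. t \<in> S \<Longrightarrow> norm (A t) \<le> R"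
    using compact_imp_bounded[OF compact_continuous_image[OF assms]]
    by (auto simp: bounded_pos)
  show ?thesis
  proof
    show "0 \<le> R * C" using C R by simp
    fix t and h :: "real^'m" assume "t \<in> S"
    then have "norm (A t) * norm h * C \<le> R * norm h * C"
      using R C by (intro mult_right_mono) auto
    with C(2)[of "A t" h] show "norm (A t *v h) \<le> R * C * norm h"
      by (simp add: mult_ac)
  qed
qed

section \<open>Dependence of the trajectory on the parameter\<close>

text \<open>All trajectories start at \<open>z0\<close>, so their difference starts at zero. Inside
  the tube the linearization bounds its derivative by a multiple of its norm plus
  \<open>norm (\<theta> - \<theta>s)\<close>, and the local Gronwall estimate keeps it
  inside.\<close>

lemma trajectory_lipschitz_in_parameter:
  fixes f :: "real \<Rightarrow> real^'n \<Rightarrow> real^'p \<Rightarrow> real^'n"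
  assumes dyn: "C1_dynamics f t0 tf \<Theta>" and "open \<Theta>" "\<theta>s \<in> \<Theta>"
    and traj: "\<And>\<theta>. \<theta> \<in> \<Theta> \<Longrightarrow> trajectory f t0 tf z0 (\<lambda>_. \<theta>) (z \<theta>)"
  obtains r C where "0 < r" "0 < C" "cball \<theta>s r \<subseteq> \<Theta>"
    and "\<And>\<theta> t. norm (\<theta> - \<theta>s) \<le> r \<Longrightarrow> t \<in> {t0..tf} \<Longrightarrow> norm (z \<theta> t - z \<theta>s t) \<le> C * norm (\<theta> - \<theta>s)"
proof -
  have deriv: "(z \<theta> has_vector_derivative f t (z \<theta> t) \<theta>) (at t within {t0..tf})"
    if "\<theta> \<in> \<Theta>" "t \<in> {t0..tf}" for \<theta> t
    using traj[OF that(1)] that(2) by (simp add: trajectory_def)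
  have init: "z \<theta> t0 = z0" if "\<theta> \<in> \<Theta>" for \<theta>
    using traj[OF that] by (simp add: trajectory_def)
  have cont: "continuous_on {t0..tf} (z \<theta>s)"
    by (rule continuous_on_vector_derivative[OF deriv[OF \<open>\<theta>s \<in> \<Theta>\<close>]])
  let ?A = "\<lambda>t. state_jacobian f t (z \<theta>s t) \<theta>s" and ?B = "\<lambda>t. param_jacobian f t (z \<theta>s t) \<theta>s"
  note jac_cont = C1_dynamics_continuous_along[OF dyn \<open>\<theta>s \<in> \<Theta>\<close> cont]
  obtain M1 where M1: "0 \<le> M1" "\<And>t h. t \<in> {t0..tf} \<Longrightarrow> norm (?A t *v h) \<le> M1 * norm h"
    using matrix_vector_mult_uniform_bound[OF jac_cont(1) compact_Icc] by blast
  obtain M2 where M2: "0 \<le> M2" "\<And>t h. t \<in> {t0..tf} \<Longrightarrow> norm (?B t *v h) \<le> M2 * norm h"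
    using matrix_vector_mult_uniform_bound[OF jac_cont(2) compact_Icc] by blast
  obtain r where r: "0 < r" "cball \<theta>s r \<subseteq> \<Theta>"
    and rem: "\<And>t y \<theta>. t \<in> {t0..tf} \<Longrightarrow> norm (y - z \<theta>s t) \<le> r \<Longrightarrow> norm (\<theta> - \<theta>s) \<le> r \<Longrightarrow>
      norm (f t y \<theta> - f t (z \<theta>s t) \<theta>s - (?A t *v (y - z \<theta>s t) + ?B t *v (\<theta> - \<theta>s)))
      \<le> 1 * (norm (y - z \<theta>s t) + norm (\<theta> - \<theta>s))"
    using C1_dynamics_uniform_remainder[OF dyn \<open>open \<Theta>\<close> \<open>\<theta>s \<in> \<Theta>\<close> cont zero_less_one] by blast
  \<comment> \<open>\<open>M1\<close> and \<open>M2\<close> bound the two Jacobians, and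
    \<open>1\<close> is the tolerance chosen for the remainder.\<close>
  define M where "M = M1 + M2 + 1"
  define C where "C = exp (3 * M * (tf - t0))"
  have "0 < C" by (simp add: C_def)
  show ?thesis
  proof
    \<comment> \<open>The factor \<open>2\<close> gives
      \<open>C * norm (\<theta> - \<theta>s) \<le> r / 2\<close>, hence the strict inequality that
      the local Gronwall estimate demands.\<close>
    show "0 < min r (r / (2 * C))" "0 < C" "cball \<theta>s (min r (r / (2 * C))) \<subseteq> \<Theta>"
      using r \<open>0 < C\<close> by auto
    fix \<theta> t assume \<theta>: "norm (\<theta> - \<theta>s) \<le> min r (r / (2 * C))" and t: "t \<in> {t0..tf}"
    have "\<theta> \<in> \<Theta>"
      using \<theta> r(2) by (auto simp: dist_norm norm_minus_commute)
    show "norm (z \<theta> t - z \<theta>s t) \<le> C * norm (\<theta> - \<theta>s)"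
      unfolding C_def
    proof (rule gronwall_zero_initial_local[where r = r and
          d' = "\<lambda>t. f t (z \<theta> t) \<theta> - f t (z \<theta>s t) \<theta>s"])
      show "((\<lambda>t. z \<theta> t - z \<theta>s t) has_vector_derivative f s (z \<theta> s) \<theta> - f s (z \<theta>s s) \<theta>s)
          (at s within {t0..tf})" if "s \<in> {t0..tf}" for s
        using that \<open>\<theta> \<in> \<Theta>\<close> \<open>\<theta>s \<in> \<Theta>\<close> by (intro has_vector_derivative_diff deriv)
      have "C * norm (\<theta> - \<theta>s) \<le> r / 2"
        using \<theta> \<open>0 < C\<close> by (simp add: field_simps)
      then show "exp (3 * M * (tf - t0)) * norm (\<theta> - \<theta>s) < r"
        using r(1) by (simp add: C_def)
      show "norm (f s (z \<theta> s) \<theta> - f s (z \<theta>s s) \<theta>s) \<le> M * (norm (z \<theta> s - z \<theta>s s) + norm (\<theta> - \<theta>s))"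
        if s: "s \<in> {t0..tf}" and small: "norm (z \<theta> s - z \<theta>s s) \<le> r" for s
      proof -
        let ?d = "z \<theta> s - z \<theta>s s" and ?h = "\<theta> - \<theta>s"
        have "norm (f s (z \<theta> s) \<theta> - f s (z \<theta>s s) \<theta>s)
            \<le> norm (?A s *v ?d + ?B s *v ?h) + (norm ?d + norm ?h)"
          using rem[OF s small, of \<theta>] \<theta> norm_triangle_sub[of "f s (z \<theta> s) \<theta> - f s (z \<theta>s s) \<theta>s"
              "?A s *v ?d + ?B s *v ?h"] by simp
        also have "\<dots> \<le> (M1 * norm ?d + M2 * norm ?h) + (norm ?d + norm ?h)"
          using M1(2)[OF s, of ?d] M2(2)[OF s, of ?h] norm_triangle_ineq[of "?A s *v ?d" "?B s *v ?h"]
          by linarith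
        also have "\<dots> \<le> M * (norm ?d + norm ?h)"
          using M1(1) M2(1) by (simp add: M_def algebra_simps)
        finally show ?thesis .
      qed
    qed (use init \<open>\<theta> \<in> \<Theta>\<close> \<open>\<theta>s \<in> \<Theta>\<close> t M1(1) M2(1) in \<open>auto simp: M_def\<close>)
  qed
qed

section \<open>Existence and uniqueness of the adjoint variable\<close>

lemma adjoint_variable_exists:
  fixes f :: "real \<Rightarrow> real^'n \<Rightarrow> real^'p \<Rightarrow> real^'n"
  assumes "t0 \<le> tf"
    and A: "continuous_on {t0..tf} (\<lambda>t. state_jacobian f t (x t) (\<theta> t))"
  shows "\<exists>a. adjoint_variable f L t0 tf \<theta> x a"
proof -
  let ?A = "\<lambda>t. state_jacobian f t (x t) (\<theta> t)"
  \<comment> \<open>The row action \<open>v v* A\<close> is \<open>transpose A *v v\<close>, so the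
    uniform bound for matrix-vector products supplies the Lipschitz constant.\<close>
  have "continuous_on {t0..tf} (\<lambda>t. transpose (?A t))"
    unfolding transpose_def by (intro continuous_intros A)
  then obtain M where M: "0 \<le> M" "\<And>t h. t \<in> {t0..tf} \<Longrightarrow> norm (transpose (?A t) *v h) \<le> M * norm h"
    using matrix_vector_mult_uniform_bound[OF _ compact_Icc] by blast
  obtain a where "a tf = - row_derivative L (x tf)"
    "\<And>t. t \<in> {t0..tf} \<Longrightarrow> (a has_vector_derivative - (a t v* ?A t)) (at t within {t0..tf})"
  proof (rule terminal_value_problem_solution[OF \<open>t0 \<le> tf\<close> M(1)])
    show "continuous_on ({t0..tf} \<times> UNIV) (\<lambda>(t, v). - (v v* ?A t))"
      unfolding split_beta
      by (intro continuous_intros bounded_bilinear.continuous_on[OF bounded_bilinear_vector_matrix_mult]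
          continuous_on_compose2[OF A]) auto
    show "norm (- (v v* ?A t) - - (w v* ?A t)) \<le> M * norm (v - w)" if "t \<in> {t0..tf}" for t v w
      using M(2)[OF that, of "v - w"]
      by (simp add: vector_matrix_mult_diff_distrib norm_minus_commute)
  qed blast
  then show ?thesis
    unfolding adjoint_variable_def by blast
qed

text \<open>Two solutions agree at \<open>tf\<close>, so under the reflection
  \<open>t0 + tf - s\<close> their difference has initial value zero. By linearity the Gronwall
  estimate applies with \<open>\<eta> = 0\<close> and forces it to vanish.\<close>

lemma adjoint_variable_unique:
  fixes f :: "real \<Rightarrow> real^'n \<Rightarrow> real^'p \<Rightarrow> real^'n"
  assumes A: "continuous_on {t0..tf} (\<lambda>t. state_jacobian f t (x t) (\<theta> t))"
    and a: "adjoint_variable f L t0 tf \<theta> x a" and b: "adjoint_variable f L t0 tf \<theta> x b"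
    and t: "t \<in> {t0..tf}"
  shows "a t = b t"
proof -
  let ?A = "\<lambda>t. state_jacobian f t (x t) (\<theta> t)" and ?\<sigma> = "\<lambda>s. t0 + tf - s"
  have "continuous_on {t0..tf} (\<lambda>t. transpose (?A t))"
    unfolding transpose_def by (intro continuous_intros A)
  then obtain M where M: "0 \<le> M" "\<And>t h. t \<in> {t0..tf} \<Longrightarrow> norm (transpose (?A t) *v h) \<le> M * norm h"
    using matrix_vector_mult_uniform_bound[OF _ compact_Icc] by blast
  define d where "d s = a s - b s" for s
  have deriv: "(d has_vector_derivative - (d s v* ?A s)) (at s within {t0..tf})" if "s \<in> {t0..tf}" for s
    using a b that has_vector_derivative_diff
    unfolding adjoint_variable_def d_def vector_matrix_mult_diff_distrib by fastforce
  have "norm ((d \<circ> ?\<sigma>) (?\<sigma> t)) \<le> exp (3 * M * (?\<sigma> t - t0)) * 0"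
  proof (rule gronwall_zero_initial[where d' = "\<lambda>s. d (?\<sigma> s) v* ?A (?\<sigma> s)"])
    show "(d \<circ> ?\<sigma> has_vector_derivative d (?\<sigma> s) v* ?A (?\<sigma> s)) (at s within {t0..tf})"
      if s: "s \<in> {t0..tf}" for s
    proof -
      \<comment> \<open>The factor \<open>-1\<close> from the chain rule cancels the minus sign of
        the adjoint equation.\<close>
      have "(?\<sigma> has_vector_derivative -1) (at s within {t0..tf})"
        by (auto intro!: derivative_eq_intros)
      moreover have "(d has_vector_derivative - (d (?\<sigma> s) v* ?A (?\<sigma> s))) (at (?\<sigma> s) within ?\<sigma> ` {t0..tf})"
        using s by (intro has_vector_derivative_within_subset[OF deriv]) auto
      ultimately show ?thesis
        using vector_diff_chain_within by fastforce
    qed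
    show "norm (d (?\<sigma> s) v* ?A (?\<sigma> s)) \<le> M * (norm ((d \<circ> ?\<sigma>) s) + 0)" if "s \<in> {t0..tf}" for s
      using M(2)[of "?\<sigma> s" "d (?\<sigma> s)"] that by simp
    show "(d \<circ> ?\<sigma>) t0 = 0"
      using a b by (simp add: d_def adjoint_variable_def)
  qed (use t M(1) in auto)
  then show ?thesis
    by (simp add: d_def)
qed

section \<open>Derivative of the terminal cost\<close>

text \<open>By the product rule and
  \<open>(a v* A) \<bullet> \<delta> = a \<bullet> (A *v \<delta>)\<close>, the function
  \<open>q\<close> below has as derivative \<open>a\<close> paired with the linearization error
  alone, which is at most \<open>Ma * R\<close>.\<close>

lemma inner_adjoint_perturbation_bound:
  fixes a \<delta> :: "real \<Rightarrow> real^'n" and A :: "real \<Rightarrow> real^'n^'n" and B :: "real \<Rightarrow> real^'p^'n"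
  assumes "t0 < tf" "\<delta> t0 = 0"
    and a: "\<And>t. t \<in> {t0..tf} \<Longrightarrow> (a has_vector_derivative - (a t v* A t)) (at t within {t0..tf})"
    and \<delta>: "\<And>t. t \<in> {t0..tf} \<Longrightarrow> (\<delta> has_vector_derivative \<delta>' t) (at t within {t0..tf})"
    and B: "continuous_on {t0..tf} B"
    and a_bound: "\<And>t. t \<in> {t0..tf} \<Longrightarrow> norm (a t) \<le> Ma"
    and rem: "\<And>t. t \<in> {t0..tf} \<Longrightarrow> norm (\<delta>' t - (A t *v \<delta> t + B t *v h)) \<le> R"
  shows "\<bar>a tf \<bullet> \<delta> tf - integral {t0..tf} (\<lambda>t. a t v* B t) \<bullet> h\<bar> \<le> (tf - t0) * (Ma * R)"
proof -
  have aB: "continuous_on {t0..tf} (\<lambda>t. a t v* B t)"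
    by (intro bounded_bilinear.continuous_on[OF bounded_bilinear_vector_matrix_mult] B
        continuous_on_vector_derivative[OF a])
  define q where "q t = a t \<bullet> \<delta> t - integral {t0..t} (\<lambda>t. a t v* B t) \<bullet> h" for t
  have "(q has_derivative (\<lambda>u. u * (a t \<bullet> (\<delta>' t - (A t *v \<delta> t + B t *v h))))) (at t within {t0..tf})"
    if "t0 \<le> t" "t \<le> tf" for t
  proof -
    have t: "t \<in> {t0..tf}" using that by simp
    note d = a[OF t, unfolded has_vector_derivative_def] \<delta>[OF t, unfolded has_vector_derivative_def]
      integral_has_vector_derivative[OF aB t, unfolded has_vector_derivative_def]
    show ?thesis
      unfolding q_def
      by (rule derivative_eq_intros d refl)+
        (simp add: fun_eq_iff inner_diff_right inner_add_right dot_lmul_matrix algebra_simps)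
  qed
  \<comment> \<open>The mean value theorem for \<open>q\<close> takes the place of integrating the
    error, so its integrability in \<open>t\<close> is never at issue.\<close>
  from mvt_simple[OF \<open>t0 < tf\<close> this] obtain t where t: "t \<in> {t0<..<tf}"
    "q tf - q t0 = (tf - t0) * (a t \<bullet> (\<delta>' t - (A t *v \<delta> t + B t *v h)))" by auto
  have "\<bar>a t \<bullet> (\<delta>' t - (A t *v \<delta> t + B t *v h))\<bar> \<le> norm (a t) * norm (\<delta>' t - (A t *v \<delta> t + B t *v h))"
    by (rule Cauchy_Schwarz_ineq2)
  also have "\<dots> \<le> Ma * R"
    using a_bound[of t] rem[of t] t order_trans[OF norm_ge_zero a_bound[of t]]
    by (intro mult_mono) auto
  finally have "\<bar>q tf - q t0\<bar> \<le> (tf - t0) * (Ma * R)"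
    using \<open>t0 < tf\<close> by (simp add: t(2) abs_mult mult_left_mono)
  then show ?thesis
    using \<open>\<delta> t0 = 0\<close> by (simp add: q_def)
qed

lemma row_derivative_works:
  assumes "g differentiable (at x)"
  shows "(g has_derivative (\<lambda>v. row_derivative g x \<bullet> v)) (at x)"
proof -
  let ?D = "frechet_derivative g (at x)"
  have D: "(g has_derivative ?D) (at x)"
    using assms frechet_derivative_works by blast
  note lin = has_derivative_linear[OF D]
  have "?D v = row_derivative g x \<bullet> v" for v
  proof -
    have "(\<Sum>i\<in>UNIV. v $ i *\<^sub>R axis i 1) = v"
      using basis_expansion[of v] by (simp add: scalar_mult_eq_scaleR)
    then have "?D v = (\<Sum>i\<in>UNIV. v $ i * ?D (axis i 1))"
      using linear_sum[OF lin, of "\<lambda>i. v $ i *\<^sub>R axis i 1" UNIV] by (simp add: linear_cmul[OF lin])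
    then show ?thesis
      by (simp add: row_derivative_def inner_vec_def mult.commute)
  qed
  then have "?D = (\<lambda>v. row_derivative g x \<bullet> v)"
    by (rule ext)
  with D show ?thesis
    by simp
qed

text \<open>The terminal condition replaces the linear part of the change in \<open>L\<close> by
  \<open>- (a tf \<bullet> \<delta> tf)\<close>, and the perturbation bound replaces that by minus
  the integral paired with \<open>h\<close>. Each replacement is allotted half of
  \<open>e\<close>.\<close>

lemma terminal_cost_has_derivative:
  fixes f :: "real \<Rightarrow> real^'n \<Rightarrow> real^'p \<Rightarrow> real^'n"
  assumes "t0 < tf" and "open \<Theta>" "\<theta>s \<in> \<Theta>" and dyn: "C1_dynamics f t0 tf \<Theta>"
    and cost: "L differentiable (at (z \<theta>s tf))"
    and traj: "\<And>\<theta>. \<theta> \<in> \<Theta> \<Longrightarrow> trajectory f t0 tf z0 (\<lambda>_. \<theta>) (z \<theta>)"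
    and adj: "adjoint_variable f L t0 tf (\<lambda>_. \<theta>s) (z \<theta>s) a"
  shows "((\<lambda>\<theta>. L (z \<theta> tf)) has_derivative
    (\<lambda>h. (- integral {t0..tf} (\<lambda>t. a t v* param_jacobian f t (z \<theta>s t) \<theta>s)) \<bullet> h)) (at \<theta>s)"
  unfolding has_derivative_at_alt
proof (intro conjI allI impI)
  let ?A = "\<lambda>t. state_jacobian f t (z \<theta>s t) \<theta>s" and ?B = "\<lambda>t. param_jacobian f t (z \<theta>s t) \<theta>s"
  let ?I = "integral {t0..tf} (\<lambda>t. a t v* ?B t)"
  show "bounded_linear (\<lambda>h. (- ?I) \<bullet> h)"
    by (rule bounded_linear_inner_right)
  have deriv: "(z \<theta> has_vector_derivative f t (z \<theta> t) \<theta>) (at t within {t0..tf})"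
    if "\<theta> \<in> \<Theta>" "t \<in> {t0..tf}" for \<theta> t
    using traj[OF that(1)] that(2) by (simp add: trajectory_def)
  have init: "z \<theta> t0 = z0" if "\<theta> \<in> \<Theta>" for \<theta>
    using traj[OF that] by (simp add: trajectory_def)
  have cont: "continuous_on {t0..tf} (z \<theta>s)"
    by (rule continuous_on_vector_derivative[OF deriv[OF \<open>\<theta>s \<in> \<Theta>\<close>]])
  have a: "(a has_vector_derivative - (a t v* ?A t)) (at t within {t0..tf})" if "t \<in> {t0..tf}" for t
    using adj that by (simp add: adjoint_variable_def)
  obtain Ma where Ma: "0 < Ma" "\<And>t. t \<in> {t0..tf} \<Longrightarrow> norm (a t) \<le> Ma"
    using compact_imp_bounded[OF compact_continuous_image[OF continuous_on_vector_derivative[OF a] compact_Icc]]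
    unfolding bounded_pos by blast
  obtain r C where r: "0 < r" "0 < C" "cball \<theta>s r \<subseteq> \<Theta>"
    and lip: "\<And>\<theta> t. norm (\<theta> - \<theta>s) \<le> r \<Longrightarrow> t \<in> {t0..tf} \<Longrightarrow> norm (z \<theta> t - z \<theta>s t) \<le> C * norm (\<theta> - \<theta>s)"
    using trajectory_lipschitz_in_parameter[where z = z, OF dyn \<open>open \<Theta>\<close> \<open>\<theta>s \<in> \<Theta>\<close> traj] by metis
  have "(L has_derivative (\<lambda>v. row_derivative L (z \<theta>s tf) \<bullet> v)) (at (z \<theta>s tf))"
    by (rule row_derivative_works[OF cost])
  then have L_diff: "\<exists>d>0. \<forall>v. norm (v - z \<theta>s tf) < d \<longrightarrow>
      norm (L v - L (z \<theta>s tf) - row_derivative L (z \<theta>s tf) \<bullet> (v - z \<theta>s tf)) \<le> e * norm (v - z \<theta>s tf)"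
    if "0 < e" for e
    using that unfolding has_derivative_at_alt by blast
  fix e :: real assume "0 < e"
  \<comment> \<open>The divisor collects what multiplies the remainder tolerance: the interval
    length, the bound \<open>Ma\<close> on the adjoint, and \<open>C + 1\<close> from bounding
    \<open>norm (\<delta> t) + norm h\<close> by \<open>(C + 1) * norm h\<close>.\<close>
  define e1 where "e1 = e / 2 / ((tf - t0) * Ma * (C + 1))"
  have "0 < e1"
    using \<open>0 < e\<close> \<open>t0 < tf\<close> Ma(1) r(2) by (simp add: e1_def)
  have "C + 1 \<noteq> 0"
    using r(2) by simp
  then have e1: "(tf - t0) * Ma * (C + 1) * e1 = e / 2"
    using \<open>t0 < tf\<close> Ma(1) by (simp add: e1_def)
  obtain r1 where r1: "0 < r1" "cball \<theta>s r1 \<subseteq> \<Theta>"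
    and rem: "\<And>t y \<theta>. t \<in> {t0..tf} \<Longrightarrow> norm (y - z \<theta>s t) \<le> r1 \<Longrightarrow> norm (\<theta> - \<theta>s) \<le> r1 \<Longrightarrow>
      norm (f t y \<theta> - f t (z \<theta>s t) \<theta>s - (?A t *v (y - z \<theta>s t) + ?B t *v (\<theta> - \<theta>s)))
      \<le> e1 * (norm (y - z \<theta>s t) + norm (\<theta> - \<theta>s))"
    using C1_dynamics_uniform_remainder[OF dyn \<open>open \<Theta>\<close> \<open>\<theta>s \<in> \<Theta>\<close> cont \<open>0 < e1\<close>] by blast
  obtain r2 where r2: "0 < r2" "\<And>v. norm (v - z \<theta>s tf) < r2 \<Longrightarrow>
      norm (L v - L (z \<theta>s tf) - row_derivative L (z \<theta>s tf) \<bullet> (v - z \<theta>s tf))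
      \<le> e / (2 * C) * norm (v - z \<theta>s tf)"
    using L_diff[of "e / (2 * C)"] \<open>0 < e\<close> r(2) by auto
  show "\<exists>d>0. \<forall>\<theta>. norm (\<theta> - \<theta>s) < d \<longrightarrow>
    norm (L (z \<theta> tf) - L (z \<theta>s tf) - (- ?I) \<bullet> (\<theta> - \<theta>s)) \<le> e * norm (\<theta> - \<theta>s)"
  proof (intro exI conjI allI impI)
    \<comment> \<open>The radii \<open>r\<close> and \<open>r1\<close> admit the parameter in the
      Lipschitz and remainder estimates. Dividing by \<open>C\<close> keeps the trajectories within
      \<open>r1\<close> of each other and the end points within \<open>r2\<close>.\<close>
    let ?d = "min (min r r1) (min (r1 / C) (r2 / C))"
    show "0 < ?d" using r r1 r2 by simp
    fix \<theta> assume \<theta>: "norm (\<theta> - \<theta>s) < ?d"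
    let ?h = "\<theta> - \<theta>s" and ?\<delta> = "\<lambda>t. z \<theta> t - z \<theta>s t"
    have "\<theta> \<in> \<Theta>"
      using \<theta> r(3) by (auto simp: dist_norm norm_minus_commute)
    have small: "C * norm ?h < r1" "C * norm ?h < r2"
      using \<theta> r(2) by (auto simp: field_simps)
    have \<delta>: "norm (?\<delta> t) \<le> C * norm ?h" if "t \<in> {t0..tf}" for t
      using lip[of \<theta> t] \<theta> that by auto
    have "\<bar>a tf \<bullet> ?\<delta> tf - ?I \<bullet> ?h\<bar> \<le> (tf - t0) * (Ma * (e1 * ((C + 1) * norm ?h)))"
    proof (rule inner_adjoint_perturbation_bound[OF \<open>t0 < tf\<close> _ a])
      show "?\<delta> t0 = 0"
        using init \<open>\<theta> \<in> \<Theta>\<close> \<open>\<theta>s \<in> \<Theta>\<close> by simp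
      show "(?\<delta> has_vector_derivative f t (z \<theta> t) \<theta> - f t (z \<theta>s t) \<theta>s) (at t within {t0..tf})"
        if "t \<in> {t0..tf}" for t
        using that \<open>\<theta> \<in> \<Theta>\<close> \<open>\<theta>s \<in> \<Theta>\<close> by (intro has_vector_derivative_diff deriv)
      show "continuous_on {t0..tf} ?B"
        by (rule C1_dynamics_continuous_along[OF dyn \<open>\<theta>s \<in> \<Theta>\<close> cont])
      show "norm (f t (z \<theta> t) \<theta> - f t (z \<theta>s t) \<theta>s - (?A t *v ?\<delta> t + ?B t *v ?h))
          \<le> e1 * ((C + 1) * norm ?h)" if t: "t \<in> {t0..tf}" for t
      proof -
        have "norm (f t (z \<theta> t) \<theta> - f t (z \<theta>s t) \<theta>s - (?A t *v ?\<delta> t + ?B t *v ?h))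
            \<le> e1 * (norm (?\<delta> t) + norm ?h)"
          using \<delta>[OF t] small \<theta> by (intro rem[OF t]) auto
        also have "\<dots> \<le> e1 * ((C + 1) * norm ?h)"
          using \<delta>[OF t] \<open>0 < e1\<close> by (intro mult_left_mono) (auto simp: algebra_simps)
        finally show ?thesis .
      qed
    qed (use Ma in auto)
    also have "\<dots> = (tf - t0) * Ma * (C + 1) * e1 * norm ?h"
      by (simp only: mult_ac)
    also have "\<dots> = e / 2 * norm ?h"
      by (simp only: e1)
    finally have adjoint_part: "\<bar>a tf \<bullet> ?\<delta> tf - ?I \<bullet> ?h\<bar> \<le> e / 2 * norm ?h" .
    have tf: "tf \<in> {t0..tf}" using \<open>t0 < tf\<close> by simp
    have "norm (L (z \<theta> tf) - L (z \<theta>s tf) - row_derivative L (z \<theta>s tf) \<bullet> ?\<delta> tf)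
        \<le> e / (2 * C) * norm (?\<delta> tf)"
      using \<delta>[OF tf] small by (intro r2) auto
    also have "\<dots> \<le> e / (2 * C) * (C * norm ?h)"
      using \<delta>[OF tf] \<open>0 < e\<close> r(2) by (intro mult_left_mono) auto
    also have "\<dots> = e / 2 * norm ?h"
      using r(2) by simp
    finally have cost_part: "\<bar>L (z \<theta> tf) - L (z \<theta>s tf) + a tf \<bullet> ?\<delta> tf\<bar> \<le> e / 2 * norm ?h"
      using adj by (simp add: adjoint_variable_def)
    \<comment> \<open>The terms \<open>a tf \<bullet> \<delta> tf\<close> cancel between the two
      halves.\<close>
    show "norm (L (z \<theta> tf) - L (z \<theta>s tf) - (- ?I) \<bullet> ?h) \<le> e * norm ?h"
      using adjoint_part cost_part unfolding inner_minus_left real_norm_def by linarith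
  qed
qed

section \<open>The gradient of the Lagrange cost\<close>

lemma lagrange_cost_on_trajectory:
  assumes "t0 < tf" "trajectory f t0 tf z0 \<theta> x"
  shows "lagrange_cost f L t0 tf a \<theta> x = L (x tf)"
proof -
  \<comment> \<open>As \<open>t0 < tf\<close>, derivatives within the interval are unique even at
    its end points, so \<open>vector_derivative\<close> returns the right-hand side of the
    ODE.\<close>
  have "vector_derivative x (at t within {t0..tf}) = f t (x t) (\<theta> t)" if "t \<in> {t0..tf}" for t
    using assms that
    by (intro vector_derivative_within_closed_interval[OF \<open>t0 < tf\<close>]) (auto simp: trajectory_def)
  then have "integral {t0..tf} (\<lambda>t. a t \<bullet> (vector_derivative x (at t within {t0..tf}) - f t (x t) (\<theta> t))) =
      integral {t0..tf} (\<lambda>_. 0)"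
    by (intro integral_cong) simp
  then show ?thesis
    by (simp add: lagrange_cost_def)
qed

theorem proposition1:
  fixes f :: "real \<Rightarrow> real ^ 'n \<Rightarrow> real ^ 'p \<Rightarrow> real ^ 'n"
    and L :: "real ^ 'n \<Rightarrow> real"
    and t0 tf :: real
    and z0 :: "real ^ 'n"
    and \<Theta> :: "(real ^ 'p) set"
    and \<theta>s :: "real ^ 'p"
    and z :: "real ^ 'p \<Rightarrow> real \<Rightarrow> real ^ 'n"
  assumes time: "t0 < tf"
    and params: "open \<Theta>" "\<theta>s \<in> \<Theta>"
    and dynamics: "C1_dynamics f t0 tf \<Theta>"
    and cost: "L differentiable (at (z \<theta>s tf))"
    and traj: "\<And>\<theta>. \<theta> \<in> \<Theta> \<Longrightarrow> trajectory f t0 tf z0 (\<lambda>_. \<theta>) (z \<theta>)"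
  shows "(\<exists>a. adjoint_variable f L t0 tf (\<lambda>_. \<theta>s) (z \<theta>s) a) \<and>
         (\<forall>a b. adjoint_variable f L t0 tf (\<lambda>_. \<theta>s) (z \<theta>s) a \<longrightarrow>
                adjoint_variable f L t0 tf (\<lambda>_. \<theta>s) (z \<theta>s) b \<longrightarrow> (\<forall>t\<in>{t0..tf}. a t = b t)) \<and>
         (\<forall>a. adjoint_variable f L t0 tf (\<lambda>_. \<theta>s) (z \<theta>s) a \<longrightarrow>
              (\<lambda>\<theta>. lagrange_cost f L t0 tf a (\<lambda>_. \<theta>) (z \<theta>)) differentiable (at \<theta>s) \<and>
              row_derivative (\<lambda>\<theta>. lagrange_cost f L t0 tf a (\<lambda>_. \<theta>) (z \<theta>)) \<theta>s =
                - integral {t0..tf} (\<lambda>t. a t v* param_jacobian f t (z \<theta>s t) \<theta>s))"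
proof (intro conjI allI impI ballI)
  have "continuous_on {t0..tf} (z \<theta>s)"
    using traj[OF params(2)] by (intro continuous_on_vector_derivative) (auto simp: trajectory_def)
  note A = C1_dynamics_continuous_along(1)[OF dynamics params(2) this]
  show "\<exists>a. adjoint_variable f L t0 tf (\<lambda>_. \<theta>s) (z \<theta>s) a"
    using time A by (intro adjoint_variable_exists) auto
  show "a t = b t" if "adjoint_variable f L t0 tf (\<lambda>_. \<theta>s) (z \<theta>s) a"
    "adjoint_variable f L t0 tf (\<lambda>_. \<theta>s) (z \<theta>s) b" "t \<in> {t0..tf}" for a b t
    by (rule adjoint_variable_unique[OF A that])
next
  fix a assume a: "adjoint_variable f L t0 tf (\<lambda>_. \<theta>s) (z \<theta>s) a"
  let ?J = "\<lambda>\<theta>. lagrange_cost f L t0 tf a (\<lambda>_. \<theta>) (z \<theta>)"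
  let ?G = "- integral {t0..tf} (\<lambda>t. a t v* param_jacobian f t (z \<theta>s t) \<theta>s)"
  have J: "(?J has_derivative (\<lambda>h. ?G \<bullet> h)) (at \<theta>s)"
  \<comment> \<open>The multiplier \<open>a\<close> stays fixed while the parameter varies. The two
    costs are compared only on \<open>\<Theta>\<close>, where trajectories are given; being open, it
    contains a neighbourhood of \<open>\<theta>s\<close>.\<close>
  proof (rule has_derivative_transform_within_open[OF _ params])
    show "((\<lambda>\<theta>. L (z \<theta> tf)) has_derivative (\<lambda>h. ?G \<bullet> h)) (at \<theta>s)"
      using time params dynamics cost traj a by (rule terminal_cost_has_derivative)
    show "L (z \<theta> tf) = ?J \<theta>" if "\<theta> \<in> \<Theta>" for \<theta>
      using lagrange_cost_on_trajectory[OF time traj[OF that]] by simp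
  qed
  then show "?J differentiable (at \<theta>s)"
    by (rule differentiableI)
  show "row_derivative ?J \<theta>s = ?G"
    unfolding row_derivative_def frechet_derivative_at[OF J, symmetric]
    by (simp add: vec_eq_iff inner_axis)
qed

end
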